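(* Feedback strictly increases the capacity region of certain continuous-time Gaussian interference channel: there exists a continuous-time white Gaussian interference channel $$Y_i(t)=\sum_{j=1}^ma_{ij}\int_0^tX_j(s)\,ds+B_i(t),\qquad t\ge0,\ i=1,\dots,m,$$ (with real channel gains $a_{ij}$, standard Brownian motions $B_1,\dots,B_m$, and power constraints $P_1,\dots,P_m>0$) whose capacity region with feedback strictly contains its capacity region without feedback.
   Context: Messages $M_1,\dots,M_m$ are independent of each other and of the Brownian motions; $M_i$ is the message of sender $i$, intended for receiver $i$, uniformly distributed on its alphabet. Without feedback, the input of sender $i$ is $X_i(s)=X_i(s,M_i)$. With feedback, sender $i$ additionally observes, causally and noiselessly, the output of receiver $i$, so $X_i(s)=X_i(s,M_i,Y_{i,0}^s)$ with $Y_{i,0}^s=\{Y_i(r):0\le r\le s\}$ (inputs are assumed to be such that the outputs uniquely exist). For $T,R_1,\dots,R_m>0$, a $(T,(e^{TR_1},\dots,e^{TR_m}),(P_1,\dots,P_m))$-code consists of message alphabets $\mathcal{M}_i=\{1,2,\dots,e^{TR_i}\}$ ($e^{TR_i}$ being understood as its integer part), encoding functions producing inputs $X_i$ on $[0,T]$ (of the non-feedback or feedback form, respectively) such that for each $i$, with probability 1, $\frac1T\int_0^TX_i^2(s)\,ds\le P_i$, and decoding functions $g_i:C[0,T]\to\mathcal{M}_i$. Its average probability of error is the average, over all message tuples $(M_1,\dots,M_m)\in\mathcal{M}_1\times\cdots\times\mathcal{M}_m$, of the conditional probability that $g_i(Y_{i,0}^T)\ne M_i$ for some $i$ given that $(M_1,\dots,M_m)$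 is sent. A rate tuple $(R_1,\dots,R_m)$ is achievable if there exists a sequence of such codes with average probability of error tending to $0$ as $T\to\infty$. The capacity region (with, respectively without, feedback) is the closure of the set of achievable rate tuples. *)

theory Defs
  imports "HOL-Probability.Probability"
begin

text \<open>
  Users are indexed by \<open>{..<m}\<close>. The parameters of a channel are the number \<open>m\<close> of users, the gains
  \<open>a i j\<close> (from sender \<open>j\<close> to receiver \<open>i\<close>) and the powers \<open>P i\<close>; the noise is a family \<open>B\<close> of
  processes on a probability space \<open>N\<close>.
\<close>

definition standard_brownian_motion :: "'w measure \<Rightarrow> (real \<Rightarrow> 'w \<Rightarrow> real) \<Rightarrow> bool" where
  "standard_brownian_motion N W \<longleftrightarrow>
     prob_space N \<and>
     (\<forall>t\<ge>0. W t \<in> borel_measurable N) \<and>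
     (\<forall>\<omega>\<in>space N. W 0 \<omega> = 0 \<and> continuous_on {0..} (\<lambda>t. W t \<omega>)) \<and>
     (\<forall>s t. 0 \<le> s \<longrightarrow> s < t \<longrightarrow>
        distributed N lborel (\<lambda>\<omega>. W t \<omega> - W s \<omega>) (normal_density 0 (sqrt (t - s)))) \<and>
     (\<forall>(n::nat) \<tau>. 0 \<le> \<tau> 0 \<longrightarrow> mono \<tau> \<longrightarrow>
        prob_space.indep_vars N (\<lambda>_. borel) (\<lambda>k \<omega>. W (\<tau> (Suc k)) \<omega> - W (\<tau> k) \<omega>) {..<n})"

definition white_gaussian_noise :: "nat \<Rightarrow> 'w measure \<Rightarrow> (nat \<Rightarrow> real \<Rightarrow> 'w \<Rightarrow> real) \<Rightarrow> bool" where
  "white_gaussian_noise m N B \<longleftrightarrow>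
     prob_space N \<and>
     (\<forall>i<m. standard_brownian_motion N (B i)) \<and>
     prob_space.indep_vars N (\<lambda>_. \<Pi>\<^sub>M t\<in>{0..}. borel) (\<lambda>i \<omega>. \<lambda>t\<in>{0..}. B i t \<omega>) {..<m}"

definition message_tuples :: "nat \<Rightarrow> real \<Rightarrow> (nat \<Rightarrow> real) \<Rightarrow> (nat \<Rightarrow> nat) set" where
  "message_tuples m T R = (\<Pi>\<^sub>E i\<in>{..<m}. {1..nat \<lfloor>exp (T * R i)\<rfloor>})"

text \<open>
  The messages and the noise live together on a product space with points \<open>(w, \<omega>)\<close>. There the message of
  sender \<open>i\<close> is the random variable \<open>w i\<close>: the messages are uniform, independent of each other and
  independent of the noise.
\<close>

definition joint_space :: "nat \<Rightarrow> 'w measure \<Rightarrow> real \<Rightarrow> (nat \<Rightarrow> real) \<Rightarrow> ((nat \<Rightarrow> nat) \<times> 'w) measure" where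
  "joint_space m N T R = uniform_count_measure (message_tuples m T R) \<Otimes>\<^sub>M N"

text \<open>
  The space \<open>C[0,T]\<close>, as extensional functions. The \<open>\<sigma>\<close>-algebra generated by the coordinates is the
  Borel \<open>\<sigma>\<close>-algebra of the supremum norm.
\<close>

definition path_space :: "real \<Rightarrow> (real \<Rightarrow> real) measure" where
  "path_space T = restrict_space (\<Pi>\<^sub>M t\<in>{0..T}. borel) {y. continuous_on {0..T} y}"

text \<open>
  \<open>f i k s y\<close> is the symbol sent by sender \<open>i\<close> at time \<open>s\<close> when its message is \<open>k\<close> and \<open>y\<close> is the path
  up to time \<open>s\<close> of the output of receiver \<open>i\<close>. Causality is enforced by \<open>channel_input\<close>, which passes
  only the restriction of the path to \<open>[0,s]\<close>.
\<close>

type_synonym encoder = "nat \<Rightarrow> nat \<Rightarrow> real \<Rightarrow> (real \<Rightarrow> real) \<Rightarrow> real"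
type_synonym 'w process = "real \<Rightarrow> (nat \<Rightarrow> nat) \<times> 'w \<Rightarrow> real"

definition feedback_encoders :: "encoder set" where
  "feedback_encoders = UNIV"

definition nonfeedback_encoders :: "encoder set" where
  "nonfeedback_encoders = {f. \<exists>x. f = (\<lambda>i k s y. x i k s)}"

definition channel_input ::
    "encoder \<Rightarrow> (nat \<Rightarrow> 'w process) \<Rightarrow> nat \<Rightarrow> 'w process" where
  "channel_input f Y i s p = f i (fst p i) s (\<lambda>r\<in>{0..s}. Y i r p)"

definition measurable_encoder :: "nat \<Rightarrow> real \<Rightarrow> (nat \<Rightarrow> real) \<Rightarrow> encoder \<Rightarrow> bool" where
  "measurable_encoder m T R f \<longleftrightarrow>
     (\<forall>i<m. \<forall>k\<in>{1..nat \<lfloor>exp (T * R i)\<rfloor>}.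
        (\<lambda>(s, y). f i k s (restrict y {0..s}))
          \<in> borel_measurable (restrict_space borel {0..T} \<Otimes>\<^sub>M path_space T))"

text \<open>
  Outputs are strong solutions of the channel equations on \<open>[0,T]\<close>: \<open>Y i t\<close> is, almost surely, a measurable
  functional of the messages and of the noise up to time \<open>t\<close>. Without this clause the equations
  could have solutions that anticipate the noise.
\<close>

definition channel_output ::
    "nat \<Rightarrow> (nat \<Rightarrow> nat \<Rightarrow> real) \<Rightarrow> 'w measure \<Rightarrow> (nat \<Rightarrow> real \<Rightarrow> 'w \<Rightarrow> real) \<Rightarrow>
     real \<Rightarrow> (nat \<Rightarrow> real) \<Rightarrow> encoder \<Rightarrow> (nat \<Rightarrow> 'w process) \<Rightarrow> bool" where
  "channel_output m a N B T R f Y \<longleftrightarrow>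
     (\<forall>i<m. \<forall>p\<in>space (joint_space m N T R). continuous_on {0..T} (\<lambda>t. Y i t p)) \<and>
     (\<forall>i<m. \<forall>t\<in>{0..T}. Y i t \<in> borel_measurable (joint_space m N T R) \<and>
        (\<exists>\<Phi>\<in>borel_measurable
               (uniform_count_measure (message_tuples m T R) \<Otimes>\<^sub>M (\<Pi>\<^sub>M j\<in>{..<m}. \<Pi>\<^sub>M r\<in>{0..t}. borel)).
           AE p in joint_space m N T R.
             Y i t p = \<Phi> (fst p, \<lambda>j\<in>{..<m}. \<lambda>r\<in>{0..t}. B j r (snd p)))) \<and>
     (AE p in joint_space m N T R.
        (\<forall>j<m. set_integrable lborel {0..T} (\<lambda>s. channel_input f Y j s p)) \<and>
        (\<forall>i<m. \<forall>t\<in>{0..T}.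
           Y i t p = (\<Sum>j<m. a i j * (LINT s:{0..t}|lborel. channel_input f Y j s p)) + B i t (snd p)))"

definition unique_channel_output ::
    "nat \<Rightarrow> (nat \<Rightarrow> nat \<Rightarrow> real) \<Rightarrow> 'w measure \<Rightarrow> (nat \<Rightarrow> real \<Rightarrow> 'w \<Rightarrow> real) \<Rightarrow>
     real \<Rightarrow> (nat \<Rightarrow> real) \<Rightarrow> encoder \<Rightarrow> (nat \<Rightarrow> 'w process) \<Rightarrow> bool" where
  "unique_channel_output m a N B T R f Y \<longleftrightarrow>
     channel_output m a N B T R f Y \<and>
     (\<forall>Y'. channel_output m a N B T R f Y' \<longrightarrow>
        (AE p in joint_space m N T R. \<forall>i<m. \<forall>t\<in>{0..T}. Y' i t p = Y i t p))"

text \<open>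
  The energy is a nonnegative integral, so an input that is not square integrable has energy \<open>\<infinity>\<close>.
  The code carries its almost surely unique output \<open>Y\<close>.
\<close>

definition code ::
    "nat \<Rightarrow> (nat \<Rightarrow> nat \<Rightarrow> real) \<Rightarrow> (nat \<Rightarrow> real) \<Rightarrow> 'w measure \<Rightarrow> (nat \<Rightarrow> real \<Rightarrow> 'w \<Rightarrow> real) \<Rightarrow>
     real \<Rightarrow> (nat \<Rightarrow> real) \<Rightarrow>
     encoder \<Rightarrow> (nat \<Rightarrow> 'w process) \<Rightarrow> (nat \<Rightarrow> (real \<Rightarrow> real) \<Rightarrow> nat) \<Rightarrow> bool" where
  "code m a P N B T R f Y g \<longleftrightarrow>
     0 < T \<and> (\<forall>i<m. 0 < R i) \<and>
     measurable_encoder m T R f \<and>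
     unique_channel_output m a N B T R f Y \<and>
     (\<forall>i<m. AE p in joint_space m N T R.
        ennreal (1 / T) * (\<integral>\<^sup>+s\<in>{0..T}. ennreal ((channel_input f Y i s p)\<^sup>2) \<partial>lborel) \<le> ennreal (P i)) \<and>
     (\<forall>i<m. g i \<in> path_space T \<rightarrow>\<^sub>M count_space {1..nat \<lfloor>exp (T * R i)\<rfloor>})"

definition average_error_probability ::
    "nat \<Rightarrow> 'w measure \<Rightarrow> real \<Rightarrow> (nat \<Rightarrow> real) \<Rightarrow>
     (nat \<Rightarrow> 'w process) \<Rightarrow> (nat \<Rightarrow> (real \<Rightarrow> real) \<Rightarrow> nat) \<Rightarrow> real" where
  "average_error_probability m N T R Y g =
     (\<Sum>w\<in>message_tuples m T R.
        cond_prob (joint_space m N T R)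
          (\<lambda>p. \<exists>i<m. g i (\<lambda>t\<in>{0..T}. Y i t p) \<noteq> fst p i) (\<lambda>p. fst p = w))
     / real (card (message_tuples m T R))"

definition achievable ::
    "encoder set \<Rightarrow> nat \<Rightarrow> (nat \<Rightarrow> nat \<Rightarrow> real) \<Rightarrow> (nat \<Rightarrow> real) \<Rightarrow>
     'w measure \<Rightarrow> (nat \<Rightarrow> real \<Rightarrow> 'w \<Rightarrow> real) \<Rightarrow> (nat \<Rightarrow> real) \<Rightarrow> bool" where
  "achievable E m a P N B R \<longleftrightarrow>
     (\<forall>i<m. 0 < R i) \<and>
     (\<exists>T f Y g.
        filterlim T at_top sequentially \<and>
        (\<forall>n. f n \<in> E \<and> code m a P N B (T n) R (f n) (Y n) (g n)) \<and>
        (\<lambda>n. average_error_probability m N (T n) R (Y n) (g n)) \<longlonglongrightarrow> 0)"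

text \<open>
  Rate tuples are points of the library's \<open>\<real>\<^sup>m\<close>, whose elements are functions vanishing outside \<open>{..<m}\<close>.
\<close>

definition capacity_region ::
    "encoder set \<Rightarrow> nat \<Rightarrow> (nat \<Rightarrow> nat \<Rightarrow> real) \<Rightarrow> (nat \<Rightarrow> real) \<Rightarrow>
     'w measure \<Rightarrow> (nat \<Rightarrow> real \<Rightarrow> 'w \<Rightarrow> real) \<Rightarrow> (nat \<Rightarrow> real) set" where
  "capacity_region E m a P N B =
     Euclidean_space m closure_of
       {R \<in> topspace (Euclidean_space m). achievable E m a P N B R}"

end

(*
  The channel has no direct links: receiver i hears only sender 1 - i. Without feedback receiver i
  learns nothing about message i, so no positive rate is achievable and the region is empty. With
  feedback each sender sees what its receiver hears, namely the other user's message, and can relay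
  it. Messages are sent by pulse position: [0, T] is cut into 2 M slots of length d, message k puts a
  pulse of height A into slot k of the first half, and the detected message of the other user puts
  one into slot M + k of the second half. A decoding step can only fail if some noise increment over
  a slot exceeds A d / 2; with M about e^T, the Gaussian tail beats the number of slots once the power
  is large enough.
*)
theory Submission
  imports Defs
begin

section \<open>Gaussian tails\<close>

lemma (in prob_space) normal_tail_bound:
  assumes X: "distributed M lborel X (normal_density 0 \<sigma>)" and \<sigma>: "0 < \<sigma>" and c: "0 \<le> c"
  shows "prob {x \<in> space M. c \<le> \<bar>X x\<bar>} \<le> sqrt 2 * exp (- c\<^sup>2 / (4 * \<sigma>\<^sup>2))"
proof -
  let ?K = "sqrt 2 * exp (- c\<^sup>2 / (4 * \<sigma>\<^sup>2))"
  let ?S = "{x::real. c \<le> \<bar>x\<bar>}"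
  have S: "?S \<in> sets lborel" by measurable
  \<comment> \<open>Half of the exponent is bounded at \<open>c\<close>; the other half is the
    exponent of a normal density with variance \<open>2 * \<sigma>\<^sup>2\<close>, whose total mass
    is 1. The factor \<open>sqrt 2\<close> is the ratio of the two normalising constants.\<close>
  have pointwise: "normal_density 0 \<sigma> x \<le> ?K * normal_density 0 (sqrt 2 * \<sigma>) x" if "c \<le> \<bar>x\<bar>" for x
  proof -
    have "c\<^sup>2 \<le> x\<^sup>2" using that c by (metis power2_abs power_mono)
    then have "- x\<^sup>2 / (2 * \<sigma>\<^sup>2) \<le> - c\<^sup>2 / (4 * \<sigma>\<^sup>2) + - x\<^sup>2 / (4 * \<sigma>\<^sup>2)"
      using \<sigma> by (simp add: field_simps)
    then have "exp (- x\<^sup>2 / (2 * \<sigma>\<^sup>2)) \<le> exp (- c\<^sup>2 / (4 * \<sigma>\<^sup>2)) * exp (- x\<^sup>2 / (4 * \<sigma>\<^sup>2))"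
      by (simp flip: exp_add)
    then have "exp (- x\<^sup>2 / (2 * \<sigma>\<^sup>2)) / sqrt (2 * pi * \<sigma>\<^sup>2)
        \<le> exp (- c\<^sup>2 / (4 * \<sigma>\<^sup>2)) * exp (- x\<^sup>2 / (4 * \<sigma>\<^sup>2)) / sqrt (2 * pi * \<sigma>\<^sup>2)"
      by (intro divide_right_mono) auto
    also have "\<dots> = ?K * (exp (- x\<^sup>2 / (4 * \<sigma>\<^sup>2)) / (sqrt 2 * sqrt (2 * pi * \<sigma>\<^sup>2)))"
      by simp
    also have "sqrt 2 * sqrt (2 * pi * \<sigma>\<^sup>2) = sqrt (2 * pi * (sqrt 2 * \<sigma>)\<^sup>2)"
      by (simp add: power_mult_distrib flip: real_sqrt_mult)
    also have "?K * (exp (- x\<^sup>2 / (4 * \<sigma>\<^sup>2)) / sqrt (2 * pi * (sqrt 2 * \<sigma>)\<^sup>2))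
        = ?K * normal_density 0 (sqrt 2 * \<sigma>) x"
      by (simp add: normal_density_def power_mult_distrib)
    finally show ?thesis by (simp add: normal_density_def)
  qed
  have "emeasure M {x \<in> space M. c \<le> \<bar>X x\<bar>} = emeasure M (X -` ?S \<inter> space M)"
    by (intro arg_cong[where f="emeasure M"]) auto
  also have "\<dots> = (\<integral>\<^sup>+x. ennreal (normal_density 0 \<sigma> x) * indicator ?S x \<partial>lborel)"
    by (rule distributed_emeasure[OF X S])
  also have "\<dots> \<le> (\<integral>\<^sup>+x. ennreal (?K * normal_density 0 (sqrt 2 * \<sigma>) x) \<partial>lborel)"
    using pointwise by (intro nn_integral_mono) (auto simp: indicator_def intro!: ennreal_leI)
  also have "\<dots> = ennreal ?K"
    using \<sigma> by (subst nn_integral_eq_integral) auto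
  finally show ?thesis
    by (simp add: emeasure_eq_measure)
qed

section \<open>Conditioning on the messages\<close>

lemma finite_message_tuples: "finite (message_tuples m T R)"
  unfolding message_tuples_def by (intro finite_PiE) auto

lemma space_joint_space: "space (joint_space m N T R) = message_tuples m T R \<times> space N"
  by (simp add: joint_space_def space_pair_measure space_uniform_count_measure)

lemma measurable_Pair_joint_space:
  "w \<in> message_tuples m T R \<Longrightarrow> Pair w \<in> N \<rightarrow>\<^sub>M joint_space m N T R"
  unfolding joint_space_def by (intro measurable_Pair1') (simp add: space_uniform_count_measure)

lemma measurable_restrict_output:
  assumes "\<And>t. t \<in> {0..T} \<Longrightarrow> Y t \<in> borel_measurable M"
    and "\<And>p. p \<in> space M \<Longrightarrow> continuous_on {0..T} (\<lambda>t. Y t p)"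
  shows "(\<lambda>p. \<lambda>t\<in>{0..T}. Y t p) \<in> M \<rightarrow>\<^sub>M path_space T"
  unfolding path_space_def
proof (intro measurable_restrict_space2 measurable_restrict assms(1))
  show "(\<lambda>p. \<lambda>t\<in>{0..T}. Y t p) \<in> space M \<rightarrow> {y. continuous_on {0..T} y}"
  proof
    fix p assume "p \<in> space M"
    have "continuous_on {0..T} (\<lambda>t\<in>{0..T}. Y t p) \<longleftrightarrow> continuous_on {0..T} (\<lambda>t. Y t p)"
      by (rule continuous_on_cong) auto
    with assms(2) \<open>p \<in> space M\<close> show "(\<lambda>t\<in>{0..T}. Y t p) \<in> {y. continuous_on {0..T} y}"
      by blast
  qed
qed

lemma measurable_coordinate: "t \<in> {0..T} \<Longrightarrow> (\<lambda>y. y t) \<in> borel_measurable (path_space T)"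
  unfolding path_space_def
  by (intro measurable_restrict_space1 measurable_component_singleton)

text \<open>All tuples carry the same positive mass and are independent of the noise, so
  conditioning on one freezes the messages and leaves the law of the noise unchanged. Error
  probabilities thereby become measures of events in \<open>N\<close> alone.\<close>

lemma cond_prob_message:
  assumes N: "prob_space N" and w: "w \<in> message_tuples m T R"
    and Q: "Measurable.pred (joint_space m N T R) Q"
  shows "cond_prob (joint_space m N T R) Q (\<lambda>p. fst p = w)
    = measure N {\<omega> \<in> space N. Q (w, \<omega>)}"
proof -
  interpret N: prob_space N by (rule N)
  let ?W = "message_tuples m T R"
  have fin: "finite ?W" by (rule finite_message_tuples)
  have Qw: "{\<omega> \<in> space N. Q (w, \<omega>)} \<in> sets N"
    using measurable_compose[OF measurable_Pair_joint_space[OF w] Q] by simp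
  have weight: "measure (joint_space m N T R) ({w} \<times> S) = measure N S / card ?W"
    if "S \<in> sets N" for S
  proof -
    have "emeasure (joint_space m N T R) ({w} \<times> S)
        = emeasure (uniform_count_measure ?W) {w} * emeasure N S"
      unfolding joint_space_def using that w
      by (intro N.emeasure_pair_measure_Times) (auto simp: sets_uniform_count_measure)
    also have "\<dots> = ennreal (measure N S / card ?W)"
      using w fin by (simp add: emeasure_uniform_count_measure N.emeasure_eq_measure
          ennreal_mult''[symmetric] mult.commute)
    finally show ?thesis by (simp add: measure_def)
  qed
  have "{p \<in> space (joint_space m N T R). Q p \<and> fst p = w} = {w} \<times> {\<omega> \<in> space N. Q (w, \<omega>)}"
    and "{p \<in> space (joint_space m N T R). fst p = w} = {w} \<times> space N"
    using w by (auto simp: space_joint_space)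
  moreover have "card ?W \<noteq> 0" using w fin by auto
  ultimately show ?thesis
    using weight[OF Qw] weight[OF sets.top] by (simp add: cond_prob_def N.prob_space)
qed

lemma pred_decoding_error:
  assumes "code m a P N B T R f Y g"
  shows "Measurable.pred (joint_space m N T R) (\<lambda>p. \<exists>i<m. g i (\<lambda>t\<in>{0..T}. Y i t p) \<noteq> fst p i)"
proof -
  have "(\<lambda>p. g i (\<lambda>t\<in>{0..T}. Y i t p)) \<in> joint_space m N T R \<rightarrow>\<^sub>M count_space UNIV" if "i < m" for i
  proof (rule measurable_compose[where N = "path_space T" and g = "g i"
        and f = "\<lambda>p. \<lambda>t\<in>{0..T}. Y i t p"])
    show "(\<lambda>p. \<lambda>t\<in>{0..T}. Y i t p) \<in> joint_space m N T R \<rightarrow>\<^sub>M path_space T"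
      using assms that
      by (intro measurable_restrict_output) (auto simp: code_def unique_channel_output_def channel_output_def)
    have "g i \<in> path_space T \<rightarrow>\<^sub>M count_space {1..nat \<lfloor>exp (T * R i)\<rfloor>}"
      using assms that by (simp add: code_def)
    then show "g i \<in> path_space T \<rightarrow>\<^sub>M count_space UNIV"
      by (rule measurable_compose[where g = "\<lambda>k. k"]) simp
  qed
  moreover have "(\<lambda>p. fst p i) \<in> joint_space m N T R \<rightarrow>\<^sub>M count_space UNIV" for i
    unfolding joint_space_def by (rule measurable_compose[OF measurable_fst]) simp
  moreover have "Measurable.pred (joint_space m N T R) (\<lambda>p. F p \<noteq> G p)"
    if "F \<in> joint_space m N T R \<rightarrow>\<^sub>M count_space UNIV"
      "G \<in> joint_space m N T R \<rightarrow>\<^sub>M count_space UNIV" for F G :: "_ \<Rightarrow> nat"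
  proof -
    \<comment> \<open>The embedding into the reals turns the disagreement of two naturals into a
      Borel event.\<close>
    have [measurable]: "(\<lambda>p. real (F p)) \<in> borel_measurable (joint_space m N T R)"
      "(\<lambda>p. real (G p)) \<in> borel_measurable (joint_space m N T R)"
      using that by (auto intro: measurable_compose)
    have "Measurable.pred (joint_space m N T R) (\<lambda>p. real (F p) \<noteq> real (G p))"
      by measurable
    then show ?thesis by simp
  qed
  ultimately have "Measurable.pred (joint_space m N T R) (\<lambda>p. g i (\<lambda>t\<in>{0..T}. Y i t p) \<noteq> fst p i)"
    if "i \<in> {..<m}" for i
    using that by (simp only: lessThan_iff)
  from pred_intros_finite(4)[where P = "\<lambda>p i. g i (\<lambda>t\<in>{0..T}. Y i t p) \<noteq> fst p i", OF finite_lessThan this]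
  show ?thesis by (simp only: Bex_def lessThan_iff)
qed

lemma average_error_probability_eq:
  assumes "prob_space N" "code m a P N B T R f Y g"
  shows "average_error_probability m N T R Y g =
    (\<Sum>w\<in>message_tuples m T R. measure N {\<omega> \<in> space N. \<exists>i<m. g i (\<lambda>t\<in>{0..T}. Y i t (w, \<omega>)) \<noteq> w i})
      / card (message_tuples m T R)"
  unfolding average_error_probability_def
  using assms by (simp add: cond_prob_message pred_decoding_error)

text \<open>No message tuple is a null set, so a property that holds almost surely on the joint
  space survives fixing the messages.\<close>

lemma AE_joint_space:
  assumes "prob_space N" "AE p in joint_space m N T R. Q p" "w \<in> message_tuples m T R"
  shows "AE \<omega> in N. Q (w, \<omega>)"
proof -
  interpret N: prob_space N by fact
  interpret U: prob_space "uniform_count_measure (message_tuples m T R)"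
    using finite_message_tuples assms(3) by (intro prob_space_uniform_count_measure) auto
  interpret pair: pair_sigma_finite "uniform_count_measure (message_tuples m T R)" N ..
  have "AE v in uniform_count_measure (message_tuples m T R). AE \<omega> in N. Q (v, \<omega>)"
    using assms(2) unfolding joint_space_def by (rule pair.AE_pair)
  moreover have "0 < card (message_tuples m T R)"
    using assms(3) finite_message_tuples card_gt_0_iff by blast
  ultimately show ?thesis
    using assms(3) unfolding uniform_count_measure_def AE_point_measure by simp
qed

section \<open>No positive rates without feedback\<close>

definition cross_gains :: "nat \<Rightarrow> nat \<Rightarrow> real" where
  "cross_gains i j = (if i = j then 0 else 1)"

text \<open>For users 0 and 1 the natural number \<open>1 - i\<close> is the other user; it denotes
  that user from here on.\<close>

lemma sum_cross_gains: "i < 2 \<Longrightarrow> (\<Sum>j<2. cross_gains i j * F j) = F (1 - i)"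
  by (auto simp: cross_gains_def numeral_2_eq_2 less_Suc_eq)

text \<open>Without feedback the output of receiver 0 is almost surely a function of message 1 and
  the noise. Two tuples that differ only in message 0 thus yield the same path, and the decoder errs
  on at least one of them. Pairing the tuples through a permutation averages this to one
  half.\<close>

lemma nonfeedback_error_ge_half:
  assumes N: "prob_space N" and f: "f \<in> nonfeedback_encoders"
    and code: "code 2 cross_gains P N B T R f Y g"
    and two: "2 \<le> nat \<lfloor>exp (T * R 0)\<rfloor>"
  shows "1 / 2 \<le> average_error_probability 2 N T R Y g"
proof -
  interpret N: prob_space N by (rule N)
  define W where "W = message_tuples 2 T R"
  define K where "K = nat \<lfloor>exp (T * R 0)\<rfloor>"
  define err where "err w = {\<omega> \<in> space N. \<exists>i<2. g i (\<lambda>t\<in>{0..T}. Y i t (w, \<omega>)) \<noteq> w i}" for w :: "nat \<Rightarrow> nat"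
  \<comment> \<open>A cyclic shift of message 0 in \<open>{1..K}\<close>, with \<open>K\<close>
    wrapped to 1. It permutes the tuples and, since \<open>2 \<le> K\<close>, always changes message
    0.\<close>
  define other where "other w = w(0 := if w 0 = K then 1 else Suc (w 0))" for w :: "nat \<Rightarrow> nat"
  obtain x where x: "f = (\<lambda>i k s y. x i k s)"
    using CollectD[OF f[unfolded nonfeedback_encoders_def]] by (elim exE)
  have W0: "w 0 \<in> {1..K}" if "w \<in> W" for w
    using PiE_mem[OF that[unfolded W_def message_tuples_def], of 0] by (simp add: K_def)
  have otherW: "other w \<in> W" if "w \<in> W" for w
  proof -
    have "(if w 0 = K then 1 else Suc (w 0)) \<in> {1..nat \<lfloor>exp (T * R 0)\<rfloor>}"
      using W0[OF that] unfolding K_def by auto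
    from PiE_fun_upd[OF this that[unfolded W_def message_tuples_def]] show ?thesis
      unfolding W_def message_tuples_def other_def
      by (simp only: insert_absorb[of "0::nat" "{..<2}"] lessThan_iff zero_less_numeral simp_thms)
  qed
  have inj: "inj_on other W"
  proof (rule inj_onI)
    fix v w assume vw: "v \<in> W" "w \<in> W" and eq: "other v = other w"
    have "(if v 0 = K then 1 else Suc (v 0)) = (if w 0 = K then 1 else Suc (w 0))"
      using fun_cong[OF eq, of 0] by (simp only: other_def fun_upd_same)
    moreover have "1 \<le> v 0" "1 \<le> w 0" using W0[OF vw(1)] W0[OF vw(2)] by simp_all
    ultimately have v0: "v 0 = w 0" by presburger
    show "v = w"
    proof
      fix i show "v i = w i"
      proof (cases "i = 0")
        case False
        then show ?thesis using fun_cong[OF eq, of i] by (simp add: other_def)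
      qed (simp add: v0)
    qed
  qed
  have finW: "finite W" by (simp add: W_def finite_message_tuples)
  have err_sets: "err w \<in> sets N" if "w \<in> W" for w
    using measurable_compose[OF measurable_Pair_joint_space[OF that[unfolded W_def]] pred_decoding_error[OF code]]
    unfolding err_def pred_def fst_conv .
  have out: "AE \<omega> in N. \<forall>t\<in>{0..T}. Y 0 t (w, \<omega>) = (LINT s:{0..t}|lborel. x 1 (w 1) s) + B 0 t \<omega>"
    if "w \<in> W" for w
  proof -
    have "AE p in joint_space 2 N T R. \<forall>i<2. \<forall>t\<in>{0..T}. Y i t p =
        (\<Sum>j<2. cross_gains i j * (LINT s:{0..t}|lborel. channel_input f Y j s p)) + B i t (snd p)"
      using code by (auto simp: code_def unique_channel_output_def channel_output_def)
    from AE_joint_space[OF N this that[unfolded W_def]] show ?thesis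
      by (elim eventually_mono) (simp add: sum_cross_gains channel_input_def x)
  qed
  have pair: "1 \<le> measure N (err w) + measure N (err (other w))" if w: "w \<in> W" for w
  proof -
    have differ: "other w 0 \<noteq> w 0" using W0[OF w] two by (auto simp: other_def K_def)
    have same: "other w 1 = w 1" by (simp add: other_def)
    have "AE \<omega> in N. \<omega> \<in> err w \<union> err (other w)"
      using out[OF w] out[OF otherW[OF w]] AE_space
    proof eventually_elim
      case (elim \<omega>)
      have "(\<lambda>t\<in>{0..T}. Y 0 t (w, \<omega>)) = (\<lambda>t\<in>{0..T}. Y 0 t (other w, \<omega>))"
        using elim same by (intro restrict_ext) simp
      then show ?case
        using elim(3) differ unfolding err_def by (auto intro: exI[of _ "0::nat"])
    qed
    then have "N.prob (err w \<union> err (other w)) = 1"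
      using err_sets[OF w] err_sets[OF otherW[OF w]] by (subst N.prob_eq_1) auto
    then show ?thesis
      using measure_Un_le[OF err_sets[OF w] err_sets[OF otherW[OF w]]] by simp
  qed
  have "real (card W) \<le> (\<Sum>w\<in>W. measure N (err w) + measure N (err (other w)))"
    using sum_mono[of W "\<lambda>_. 1::real", OF pair] by simp
  \<comment> \<open>An injective self-map of a finite set is onto, so summing over
    \<open>other w\<close> is summing over \<open>w\<close>.\<close>
  also have "\<dots> = 2 * (\<Sum>w\<in>W. measure N (err w))"
    using sum.reindex[OF inj, of "\<lambda>w. measure N (err w)"] endo_inj_surj[OF finW _ inj] otherW
    by (auto simp: sum.distrib image_subset_iff)
  finally have "real (card W) \<le> 2 * (\<Sum>w\<in>W. measure N (err w))" .
  \<comment> \<open>Over an empty \<open>W\<close> the average would be \<open>0 / 0 = 0\<close>, so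
    \<open>W\<close> must be shown to be inhabited.\<close>
  moreover have "W \<noteq> {}"
  proof -
    have "0 < R 1" "0 < T" using code by (auto simp: code_def)
    then have "1 \<le> nat \<lfloor>exp (T * R 1)\<rfloor>" by (simp add: le_nat_iff)
    then show ?thesis using two by (auto simp: W_def message_tuples_def PiE_eq_empty_iff less_2_cases_iff)
  qed
  ultimately show ?thesis
    using finW by (simp add: average_error_probability_eq[OF N code] err_def W_def card_gt_0_iff field_simps)
qed

text \<open>The error cannot fall below one half once sender 0 has two messages. Achievability
  demands strictly positive rates, so nothing is left to take the closure of, and not even the
  origin is in the region.\<close>

lemma nonfeedback_capacity_region_empty:
  assumes "prob_space N"
  shows "capacity_region nonfeedback_encoders 2 cross_gains P N B = {}"
proof -
  have "\<not> achievable nonfeedback_encoders 2 cross_gains P N B R" for R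
  proof
    assume "achievable nonfeedback_encoders 2 cross_gains P N B R"
    then obtain T f Y g where R: "0 < R 0" and T: "filterlim T at_top sequentially"
      and code: "\<And>n. f n \<in> nonfeedback_encoders" "\<And>n. code 2 cross_gains P N B (T n) R (f n) (Y n) (g n)"
      and lim: "(\<lambda>n. average_error_probability 2 N (T n) R (Y n) (g n)) \<longlonglongrightarrow> 0"
      unfolding achievable_def by fastforce
    \<comment> \<open>Beyond this threshold \<open>exp (T n * R 0)\<close> is at least 2.\<close>
    have "eventually (\<lambda>n. ln 2 / R 0 \<le> T n) sequentially"
      using T by (simp add: filterlim_at_top)
    moreover have "eventually (\<lambda>n. average_error_probability 2 N (T n) R (Y n) (g n) < 1 / 2) sequentially"
      using lim by (rule order_tendstoD) simp
    ultimately have "eventually (\<lambda>n. False) sequentially"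
    proof eventually_elim
      case (elim n)
      then have "ln 2 \<le> T n * R 0" using R by (simp add: field_simps)
      then have "2 \<le> exp (T n * R 0)" by (metis exp_ln exp_le_cancel_iff zero_less_numeral)
      then have "2 \<le> nat \<lfloor>exp (T n * R 0)\<rfloor>" by (simp add: le_nat_iff le_floor_iff)
      then show ?case
        using nonfeedback_error_ge_half[OF assms code, of n] elim by simp
    qed
    then show False by simp
  qed
  then show ?thesis by (simp add: capacity_region_def)
qed

section \<open>Pulse-position relaying for a fixed noise path\<close>

locale relay =
  fixes M :: nat and d A :: real
  assumes M_ge_1: "1 \<le> M" and d_pos: "0 < d" and A_pos: "0 < A"
begin

definition horizon :: real where "horizon = 2 * real M * d"

text \<open>Slots are half-open, so pulses in different slots never overlap, and they are counted
  from 1 like the messages: \<open>1\<close> to \<open>M\<close> fill the first half,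
  \<open>M + 1\<close> to \<open>2 * M\<close> the second.\<close>

definition pulse :: "nat \<Rightarrow> real \<Rightarrow> real" where
  "pulse k s = A * indicator {(real k - 1) * d..<real k * d} s"

text \<open>The integral of \<open>pulse k\<close> from 0 to \<open>t\<close>, for
  \<open>1 \<le> k\<close> and \<open>0 \<le> t\<close>: zero before the slot, \<open>A * d\<close>
  after it. The form with \<open>min\<close> avoids cases and is visibly continuous in
  \<open>t\<close>.\<close>

definition ramp :: "nat \<Rightarrow> real \<Rightarrow> real" where
  "ramp k t = A * (min t (real k * d) - min t ((real k - 1) * d))"

definition slot :: "(real \<Rightarrow> real) \<Rightarrow> nat \<Rightarrow> real" where
  "slot y k = y (real k * d) - y ((real k - 1) * d)"

text \<open>The disjunct \<open>M \<le> k\<close> makes \<open>M\<close> the default when no slot stands out.\<close>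

definition detect :: "nat \<Rightarrow> (real \<Rightarrow> real) \<Rightarrow> nat" where
  "detect n y = (LEAST k. 1 \<le> k \<and> (M \<le> k \<or> A * d / 2 < slot y (n + k)))"

text \<open>The offset 0 makes \<open>detect\<close> read the first half of the fed-back path. The
  estimate is formed at all times \<open>s\<close>, but it reaches the channel only in the second
  half, when the first half of the path is known.\<close>

definition relay_encoder :: encoder where
  "relay_encoder i k s y = pulse k s + pulse (M + detect 0 y) s"

text \<open>What receiver \<open>i\<close> would hear if nobody relayed.\<close>

definition first_phase :: "(nat \<Rightarrow> nat) \<Rightarrow> (nat \<Rightarrow> real \<Rightarrow> real) \<Rightarrow> nat \<Rightarrow> real \<Rightarrow> real" where
  "first_phase w b i t = ramp (w (1 - i)) t + b i t"

text \<open>The solution of the feedback equations in closed form. It is explicit because the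
  relayed estimate is computed from the first phase, before any relayed pulse is sent.\<close>

definition relay_output :: "(nat \<Rightarrow> nat) \<Rightarrow> (nat \<Rightarrow> real \<Rightarrow> real) \<Rightarrow> nat \<Rightarrow> real \<Rightarrow> real" where
  "relay_output w b i t = first_phase w b i t + ramp (M + detect 0 (first_phase w b (1 - i))) t"

lemma detect_bounds: "1 \<le> detect n y" "detect n y \<le> M"
proof -
  show "1 \<le> detect n y"
    unfolding detect_def using LeastI[of "\<lambda>k. 1 \<le> k \<and> (M \<le> k \<or> A * d / 2 < slot y (n + k))" M] M_ge_1
    by blast
  show "detect n y \<le> M"
    unfolding detect_def using M_ge_1 by (intro Least_le) simp
qed

text \<open>The search in \<open>detect\<close> stops at \<open>k = M\<close> whatever the path is,
  so nothing past slot \<open>n + M\<close> is consulted.\<close>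

lemma detect_cong:
  assumes "\<And>k. 1 \<le> k \<Longrightarrow> k \<le> M \<Longrightarrow> slot y (n + k) = slot z (n + k)"
  shows "detect n y = detect n z"
  unfolding detect_def using assms by (intro arg_cong[where f = Least] ext) (metis nle_le)

lemma detect_eqI:
  assumes "1 \<le> l" "l \<le> M" and "A * d / 2 < slot y (n + l)"
    and "\<And>k. 1 \<le> k \<Longrightarrow> k \<le> M \<Longrightarrow> k \<noteq> l \<Longrightarrow> slot y (n + k) \<le> A * d / 2"
  shows "detect n y = l"
  unfolding detect_def
proof (rule Least_equality)
  show "1 \<le> l \<and> (M \<le> l \<or> A * d / 2 < slot y (n + l))" using assms by simp
  fix k assume k: "1 \<le> k \<and> (M \<le> k \<or> A * d / 2 < slot y (n + k))"
  show "l \<le> k"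
  proof (rule ccontr)
    assume "\<not> l \<le> k"
    then show False using k assms(2) assms(4)[of k] by auto
  qed
qed

lemma measurable_detect:
  assumes "\<And>k. 1 \<le> k \<Longrightarrow> k \<le> M \<Longrightarrow> (\<lambda>q. slot (y q) (n + k)) \<in> borel_measurable Q"
  shows "(\<lambda>q. detect n (y q)) \<in> Q \<rightarrow>\<^sub>M count_space UNIV"
  unfolding detect_def
proof (rule measurable_Least)
  fix k
  show "Measurable.pred Q (\<lambda>q. 1 \<le> k \<and> (M \<le> k \<or> A * d / 2 < slot (y q) (n + k)))"
  \<comment> \<open>Only here does the predicate consult the path; otherwise it depends on
    \<open>k\<close> alone.\<close>
  proof (cases "1 \<le> k \<and> k < M")
    case True
    then have [measurable]: "(\<lambda>q. slot (y q) (n + k)) \<in> borel_measurable Q" using assms by simp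
    show ?thesis by measurable
  next
    case False
    then have "(\<lambda>q. 1 \<le> k \<and> (M \<le> k \<or> A * d / 2 < slot (y q) (n + k))) = (\<lambda>q. 1 \<le> k)" by auto
    then show ?thesis by simp
  qed
qed

lemma slot_times: "1 \<le> k \<Longrightarrow> 0 \<le> (real k - 1) * d" "(real k - 1) * d \<le> real k * d"
  using d_pos by (simp_all add: mult_right_mono)

lemma slot_time_mono: "k \<le> l \<Longrightarrow> real k * d \<le> real l * d"
  using d_pos by (simp add: mult_right_mono)

lemma slot_time_less: "k < l \<Longrightarrow> real k * d \<le> (real l - 1) * d"
  using d_pos by (intro mult_right_mono) auto

lemma horizon_eq: "horizon = real (M + M) * d"
  by (simp add: horizon_def)

lemma measurable_slot: "1 \<le> k \<Longrightarrow> k \<le> M + M \<Longrightarrow> (\<lambda>y. slot y k) \<in> borel_measurable (path_space horizon)"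
  unfolding slot_def using slot_times[of k] slot_time_mono[of k "M + M"]
  by (intro borel_measurable_diff measurable_coordinate) (auto simp: horizon_eq)

lemma horizon_pos: "0 < horizon"
  using M_ge_1 d_pos by (simp add: horizon_def)

lemma pulse_integrable: "set_integrable lborel {0..t} (pulse k)"
  and integral_pulse: "1 \<le> k \<Longrightarrow> 0 \<le> t \<Longrightarrow> (LINT s:{0..t}|lborel. pulse k s) = ramp k t"
proof -
  let ?a = "(real k - 1) * d" and ?b = "real k * d"
  let ?S = "{0..t} \<inter> {?a..<?b}"
  have eq: "(\<lambda>s. indicator {0..t} s *\<^sub>R pulse k s) = (\<lambda>s. A * indicator ?S s)"
    by (auto simp: pulse_def indicator_def)
  have "emeasure lborel ?S \<le> emeasure lborel {0..t}" by (intro emeasure_mono) auto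
  also have "\<dots> < \<infinity>" by (simp add: emeasure_lborel_Icc_eq)
  finally have fin: "emeasure lborel ?S < \<infinity>" .
  then show "set_integrable lborel {0..t} (pulse k)"
    unfolding set_integrable_def eq by (intro integrable_mult_right) (simp add: integrable_indicator_iff)
  assume k: "1 \<le> k" and t: "0 \<le> t"
  note times = slot_times(1)[OF k] slot_times(2)[of k]
  have "?S = (if t < ?a then {} else if t < ?b then {?a..t} else {?a..<?b})"
    using times t by auto
  then have "measure lborel ?S = min t ?b - min t ?a"
    using times by auto
  then show "(LINT s:{0..t}|lborel. pulse k s) = ramp k t"
    unfolding set_lebesgue_integral_def eq ramp_def by simp
qed

lemma slot_add: "slot (\<lambda>t. f t + g t) k = slot f k + slot g k"
  by (simp add: slot_def)

text \<open>A ramp is flat outside its own slot, so slot increments read off pulse positions without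
  crosstalk.\<close>

lemma slot_ramp: "slot (ramp k) l = (if l = k then A * d else 0)"
proof (cases l k rule: linorder_cases)
  case less
  then show ?thesis
    using slot_time_less[OF less] slot_times(2)[of l] slot_times(2)[of k]
    by (simp add: slot_def ramp_def)
next
  case equal
  then show ?thesis
    using slot_times(2)[of l] by (simp add: slot_def ramp_def algebra_simps)
next
  case greater
  then show ?thesis
    using slot_time_less[OF greater] slot_times(2)[of l] slot_times(2)[of k]
    by (simp add: slot_def ramp_def)
qed

lemma ramp_eq_0: "t \<le> (real k - 1) * d \<Longrightarrow> ramp k t = 0"
  using slot_times(2)[of k] by (simp add: ramp_def)

text \<open>Before time \<open>M * d\<close> the relayed pulse is zero whatever the estimate; from
  then on \<open>{0..s}\<close> contains every time that the estimate reads. The relay may therefore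
  be analysed as if it saw the whole path.\<close>

lemma relayed_pulse_causal:
  "pulse (M + detect 0 (restrict y {0..s})) s = pulse (M + detect 0 y) s"
proof (cases "s < real M * d")
  case True
  have "pulse (M + detect 0 z) s = 0" for z
    using True slot_time_less[of M "M + detect 0 z"] detect_bounds[of 0 z]
    by (auto simp: pulse_def indicator_def)
  then show ?thesis by simp
next
  case False
  have "slot (restrict y {0..s}) (0 + k) = slot y (0 + k)" if "1 \<le> k" "k \<le> M" for k
    using that False slot_times[of k] slot_time_mono[of k M] by (simp add: slot_def)
  then show ?thesis by (metis detect_cong)
qed

text \<open>A relayed pulse starts no earlier than \<open>M * d\<close> and leaves the first
  \<open>M\<close> slots untouched. This breaks the feedback loop: the estimates are functions of
  messages and noise only, which gives both existence and uniqueness of the output.\<close>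

lemma detect_first_phase:
  assumes "\<And>t. t \<in> {0..horizon} \<Longrightarrow> y t = first_phase w b i t + ramp (M + l) t" and "1 \<le> l"
  shows "detect 0 y = detect 0 (first_phase w b i)"
proof (rule detect_cong)
  fix k assume k: "1 \<le> k" "k \<le> M"
  have "y t = first_phase w b i t" if "0 \<le> t" "t \<le> real k * d" for t
  proof -
    have "t \<le> (real (M + l) - 1) * d"
      using that slot_time_mono[of k M] slot_time_less[of M "M + l"] k assms(2) by simp
    moreover have "t \<le> horizon" using that slot_time_mono[of k "M + M"] k by (simp add: horizon_eq)
    ultimately show ?thesis using assms(1)[of t] that ramp_eq_0 by simp
  qed
  then show "slot y (0 + k) = slot (first_phase w b i) (0 + k)"
    using slot_times[of k] k by (simp add: slot_def)
qed

lemma relay_output_fixed_point: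
  "relay_output w b i t
    = ramp (w (1 - i)) t + ramp (M + detect 0 (relay_output w b (1 - i))) t + b i t"
proof -
  have "detect 0 (relay_output w b (1 - i)) = detect 0 (first_phase w b (1 - i))"
    by (rule detect_first_phase[OF relay_output_def detect_bounds(1)])
  then show ?thesis by (simp add: relay_output_def first_phase_def)
qed

lemma relay_output_unique:
  assumes y: "\<And>i t. i < 2 \<Longrightarrow> t \<in> {0..horizon} \<Longrightarrow>
      y i t = ramp (w (1 - i)) t + ramp (M + detect 0 (y (1 - i))) t + b i t"
    and "i < 2" "t \<in> {0..horizon}"
  shows "y i t = relay_output w b i t"
proof -
  have "detect 0 (y (1 - i)) = detect 0 (first_phase w b (1 - i))"
    using y[of "1 - i"] \<open>i < 2\<close>
    by (intro detect_first_phase[where l = "detect 0 (y (1 - (1 - i)))"] detect_bounds(1))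
      (simp add: first_phase_def)
  then show ?thesis using y[OF assms(2,3)] by (simp add: relay_output_def first_phase_def)
qed

text \<open>A pulse raises its slot by \<open>A * d\<close>. With all noise increments below half of
  that, the threshold \<open>A * d / 2\<close> separates the slot with the pulse from the others,
  first at the relaying sender and then at the receiver.\<close>

lemma relay_decodes:
  assumes w: "\<And>i. i < 2 \<Longrightarrow> 1 \<le> w i \<and> w i \<le> M"
    and b: "\<And>j k. j < 2 \<Longrightarrow> 1 \<le> k \<Longrightarrow> k \<le> M + M \<Longrightarrow> \<bar>slot (b j) k\<bar> < A * d / 2"
    and i: "i < 2"
  shows "detect M (restrict (relay_output w b i) {0..horizon}) = w i"
proof -
  have first: "detect 0 (first_phase w b j) = w (1 - j)" if j: "j < 2" for j
  proof (rule detect_eqI)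
    show "1 \<le> w (1 - j)" "w (1 - j) \<le> M" using w[of "1 - j"] by auto
    have "slot (first_phase w b j) k = (if k = w (1 - j) then A * d else 0) + slot (b j) k" for k
      unfolding first_phase_def[abs_def] slot_add slot_ramp ..
    then show "A * d / 2 < slot (first_phase w b j) (0 + w (1 - j))"
      and "\<And>k. 1 \<le> k \<Longrightarrow> k \<le> M \<Longrightarrow> k \<noteq> w (1 - j) \<Longrightarrow> slot (first_phase w b j) (0 + k) \<le> A * d / 2"
      using b[OF j] w[of "1 - j"] by (force simp: abs_less_iff)+
  qed
  \<comment> \<open>Two hops lead back to user \<open>i\<close>: sender \<open>1 - i\<close> has
    detected \<open>w i\<close> and relays it to receiver \<open>i\<close>.\<close>
  have "1 - (1 - i) = i" using i by auto
  then have out: "relay_output w b i = (\<lambda>t. (ramp (w (1 - i)) t + b i t) + ramp (M + w i) t)"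
    using first[of "1 - i"] by (auto simp: relay_output_def first_phase_def)
  have slots: "slot (relay_output w b i) (M + k) = slot (b i) (M + k) + (if k = w i then A * d else 0)"
    if "1 \<le> k" for k
  proof -
    \<comment> \<open>The direct pulse sits in one of the first \<open>M\<close> slots and does not
      disturb the second half.\<close>
    have "M + k \<noteq> w (1 - i)" using w[of "1 - i"] that by fastforce
    then show ?thesis unfolding out slot_add slot_ramp by simp
  qed
  have "detect M (relay_output w b i) = w i"
  proof (rule detect_eqI)
    show "1 \<le> w i" "w i \<le> M" using w[OF i] by auto
    show "A * d / 2 < slot (relay_output w b i) (M + w i)"
      using slots[of "w i"] b[OF i, of "M + w i"] w[OF i] by (simp add: abs_less_iff)
    show "slot (relay_output w b i) (M + k) \<le> A * d / 2" if "1 \<le> k" "k \<le> M" "k \<noteq> w i" for k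
      using slots[of k] b[OF i, of "M + k"] that by (simp add: abs_less_iff)
  qed
  moreover have "detect M (restrict (relay_output w b i) {0..horizon}) = detect M (relay_output w b i)"
  proof (rule detect_cong)
    fix k assume "1 \<le> k" "k \<le> M"
    then show "slot (restrict (relay_output w b i) {0..horizon}) (M + k) = slot (relay_output w b i) (M + k)"
      using slot_times[of "M + k"] slot_time_mono[of "M + k" "M + M"] by (simp add: slot_def horizon_eq)
  qed
  ultimately show ?thesis by simp
qed

text \<open>The two pulses lie in disjoint slots, so the square of their sum has no cross term, and
  each has energy at most \<open>A\<^sup>2 * d\<close>.\<close>

lemma relay_energy:
  assumes "k \<le> M" "1 \<le> l"
  shows "(\<integral>\<^sup>+s\<in>{0..horizon}. ennreal ((pulse k s + pulse (M + l) s)\<^sup>2) \<partial>lborel) \<le> ennreal (2 * A\<^sup>2 * d)"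
proof -
  let ?S = "\<lambda>k. {(real k - 1) * d..<real k * d}"
  have disj: "?S k \<inter> ?S (M + l) = {}"
    using slot_time_less[of k "M + l"] assms by auto
  have "(\<integral>\<^sup>+s\<in>{0..horizon}. ennreal ((pulse k s + pulse (M + l) s)\<^sup>2) \<partial>lborel)
      \<le> (\<integral>\<^sup>+s. ennreal (A\<^sup>2) * (indicator (?S k) s + indicator (?S (M + l)) s) \<partial>lborel)"
  proof (rule nn_integral_mono)
    fix s
    show "ennreal ((pulse k s + pulse (M + l) s)\<^sup>2) * indicator {0..horizon} s
        \<le> ennreal (A\<^sup>2) * (indicator (?S k) s + indicator (?S (M + l)) s)"
      using disj by (auto simp: pulse_def indicator_def)
  qed
  also have "\<dots> = ennreal (A\<^sup>2) * (emeasure lborel (?S k) + emeasure lborel (?S (M + l)))"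
    by (simp add: nn_integral_cmult nn_integral_add)
  also have "\<dots> = ennreal (A\<^sup>2) * (ennreal d + ennreal d)"
    using slot_times(2)[of k] slot_times(2)[of "M + l"]
    by (simp add: emeasure_lborel_Ico algebra_simps)
  also have "\<dots> = ennreal (2 * A\<^sup>2 * d)"
    using d_pos by (simp add: ennreal_plus[symmetric] ennreal_mult''[symmetric] algebra_simps del: ennreal_plus)
  finally show ?thesis .
qed

end

section \<open>The relay code on the noisy channel\<close>

locale relay_channel = relay +
  fixes N :: "'w measure" and B :: "nat \<Rightarrow> real \<Rightarrow> 'w \<Rightarrow> real" and R P :: "nat \<Rightarrow> real"
  assumes noise: "white_gaussian_noise 2 N B"
    and rate_pos: "\<And>i. i < 2 \<Longrightarrow> 0 < R i"
    and alphabet: "\<And>i. i < 2 \<Longrightarrow> nat \<lfloor>exp (horizon * R i)\<rfloor> = M"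
    and power: "\<And>i. i < 2 \<Longrightarrow> A\<^sup>2 \<le> P i * M"
begin

abbreviation joint :: "((nat \<Rightarrow> nat) \<times> 'w) measure" where
  "joint \<equiv> joint_space 2 N horizon R"

definition relay_process :: "nat \<Rightarrow> 'w process" where
  "relay_process i t p = relay_output (fst p) (\<lambda>j r. B j r (snd p)) i t"

definition relay_decoder :: "nat \<Rightarrow> (real \<Rightarrow> real) \<Rightarrow> nat" where
  "relay_decoder i = detect M"

lemma prob_space_noise: "prob_space N"
  using noise by (simp add: white_gaussian_noise_def)

lemma brownian: "j < 2 \<Longrightarrow> standard_brownian_motion N (B j)"
  using noise by (simp add: white_gaussian_noise_def)

lemma noise_measurable: "j < 2 \<Longrightarrow> 0 \<le> t \<Longrightarrow> B j t \<in> borel_measurable N"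
  using brownian by (simp add: standard_brownian_motion_def)

lemma message_bounds:
  "w \<in> message_tuples 2 horizon R \<Longrightarrow> i < 2 \<Longrightarrow> 1 \<le> w i \<and> w i \<le> M"
  using alphabet[of i] PiE_mem[of w "{..<2}" "\<lambda>i. {1..nat \<lfloor>exp (horizon * R i)\<rfloor>}" i]
  by (simp add: message_tuples_def)

lemma relay_input:
  assumes "0 \<le> s"
  shows "channel_input relay_encoder Y i s p = pulse (fst p i) s + pulse (M + detect 0 (\<lambda>r. Y i r p)) s"
  by (simp add: channel_input_def relay_encoder_def relayed_pulse_causal)

lemma relay_input_integrable:
  "set_integrable lborel {0..t} (\<lambda>s. channel_input relay_encoder Y i s p)"
proof -
  have "set_integrable lborel {0..t} (\<lambda>s. pulse (fst p i) s + pulse (M + detect 0 (\<lambda>r. Y i r p)) s)"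
    by (intro set_integral_add pulse_integrable)
  then show ?thesis
    by (subst set_integrable_cong[OF refl refl]) (auto simp: relay_input)
qed

lemma integral_relay_input:
  assumes "1 \<le> fst p i" "0 \<le> t"
  shows "(LINT s:{0..t}|lborel. channel_input relay_encoder Y i s p)
    = ramp (fst p i) t + ramp (M + detect 0 (\<lambda>r. Y i r p)) t"
proof -
  have "(LINT s:{0..t}|lborel. channel_input relay_encoder Y i s p)
      = (LINT s:{0..t}|lborel. pulse (fst p i) s + pulse (M + detect 0 (\<lambda>r. Y i r p)) s)"
    by (intro set_lebesgue_integral_cong) (auto simp: relay_input)
  then show ?thesis
    using assms M_ge_1 by (simp add: set_integral_add pulse_integrable integral_pulse)
qed

lemma channel_equation:
  assumes "p \<in> space joint" "i < 2" "0 \<le> t"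
  shows "(\<Sum>j<2. cross_gains i j * (LINT s:{0..t}|lborel. channel_input relay_encoder Y j s p))
    = ramp (fst p (1 - i)) t + ramp (M + detect 0 (\<lambda>r. Y (1 - i) r p)) t"
proof -
  have "1 \<le> fst p (1 - i)"
    using assms message_bounds[of "fst p" "1 - i"] by (auto simp: space_joint_space)
  then show ?thesis
    using assms by (simp only: sum_cross_gains integral_relay_input)
qed

text \<open>Evidence that the output is a strong solution: up to time \<open>M * d\<close> it
  involves only the current noise, and afterwards the estimate reads only past noise. A single
  functional serves all messages and noise paths, so measurability of the process also follows from
  it.\<close>

lemma relay_output_adapted:
  assumes "i < 2" "t \<in> {0..horizon}"
  shows "\<exists>\<Phi>\<in>borel_measurable (uniform_count_measure (message_tuples 2 horizon R)
      \<Otimes>\<^sub>M (\<Pi>\<^sub>M j\<in>{..<2}. \<Pi>\<^sub>M r\<in>{0..t}. borel)).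
    \<forall>w b. relay_output w b i t = \<Phi> (w, \<lambda>j\<in>{..<2}. \<lambda>r\<in>{0..t}. b j r)"
proof -
  let ?Q = "uniform_count_measure (message_tuples 2 horizon R)
      \<Otimes>\<^sub>M (\<Pi>\<^sub>M j\<in>{..<2::nat}. \<Pi>\<^sub>M r\<in>{0..t}. borel :: real measure)"
  \<comment> \<open>The relayed term vanishes up to time \<open>M * d\<close>. It is cut out
    explicitly because its \<open>detect\<close> would read the noise beyond
    \<open>t\<close>.\<close>
  define \<Phi> where "\<Phi> q = first_phase (fst q) (snd q) i t
      + (if t \<le> real M * d then 0 else ramp (M + detect 0 (first_phase (fst q) (snd q) (1 - i))) t)"
    for q :: "(nat \<Rightarrow> nat) \<times> (nat \<Rightarrow> real \<Rightarrow> real)"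
  have noise: "(\<lambda>q. snd q j r) \<in> borel_measurable ?Q" if "j < 2" "r \<in> {0..t}" for j r
    using that
    by (intro measurable_compose[OF measurable_snd] measurable_compose[OF measurable_component_singleton]
        measurable_component_singleton) auto
  have message: "(\<lambda>q. fst q j) \<in> ?Q \<rightarrow>\<^sub>M count_space UNIV" for j
    by (rule measurable_compose[OF measurable_fst]) simp
  have ramp: "(\<lambda>q. ramp (F q) r) \<in> borel_measurable ?Q" if "F \<in> ?Q \<rightarrow>\<^sub>M count_space UNIV" for F r
    using measurable_compose[OF that, of "\<lambda>k. ramp k r" borel] by simp
  have first: "(\<lambda>q. first_phase (fst q) (snd q) j r) \<in> borel_measurable ?Q" if "j < 2" "r \<in> {0..t}" for j r
    unfolding first_phase_def using that by (intro borel_measurable_add ramp message noise)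
  have relayed: "(\<lambda>q. ramp (M + detect 0 (first_phase (fst q) (snd q) (1 - i))) t) \<in> borel_measurable ?Q"
    if "\<not> t \<le> real M * d"
  proof -
    have "(\<lambda>q. slot (first_phase (fst q) (snd q) (1 - i)) (0 + k)) \<in> borel_measurable ?Q"
      if "1 \<le> k" "k \<le> M" for k
      unfolding slot_def using that \<open>\<not> t \<le> real M * d\<close> slot_times[of k] slot_time_mono[of k M]
      by (intro borel_measurable_diff first) auto
    then have "(\<lambda>q. detect 0 (first_phase (fst q) (snd q) (1 - i))) \<in> ?Q \<rightarrow>\<^sub>M count_space UNIV"
      by (rule measurable_detect)
    from measurable_compose[OF this, of "\<lambda>k. ramp (M + k) t" borel] show ?thesis by simp
  qed
  have "\<Phi> \<in> borel_measurable ?Q"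
    unfolding \<Phi>_def[abs_def] using assms relayed
    by (cases "t \<le> real M * d") (auto intro!: borel_measurable_add first)
  moreover have "relay_output w b i t = \<Phi> (w, \<lambda>j\<in>{..<2}. \<lambda>r\<in>{0..t}. b j r)" for w b
  proof -
    let ?b = "\<lambda>j\<in>{..<2}. \<lambda>r\<in>{0..t}. b j r"
    have first_eq: "first_phase w ?b j r = first_phase w b j r" if "j < 2" "r \<in> {0..t}" for j r
      using that by (simp add: first_phase_def)
    show ?thesis
    proof (cases "t \<le> real M * d")
      case True
      then have "t \<le> (real (M + detect 0 (first_phase w b (1 - i))) - 1) * d"
        using slot_time_less[of M "M + detect 0 (first_phase w b (1 - i))"]
          detect_bounds(1)[of 0 "first_phase w b (1 - i)"] by linarith
      then show ?thesis
        using True first_eq[of i t] assms by (simp add: \<Phi>_def relay_output_def ramp_eq_0)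
    next
      case False
      have "detect 0 (first_phase w ?b (1 - i)) = detect 0 (first_phase w b (1 - i))"
      proof (rule detect_cong)
        fix k assume "1 \<le> k" "k \<le> M"
        then show "slot (first_phase w ?b (1 - i)) (0 + k) = slot (first_phase w b (1 - i)) (0 + k)"
          using False slot_times[of k] slot_time_mono[of k M] unfolding slot_def
          by (intro arg_cong2[where f = minus] first_eq) auto
      qed
      then show ?thesis
        using False first_eq[of i t] assms by (simp add: \<Phi>_def relay_output_def)
    qed
  qed
  ultimately show ?thesis by blast
qed

lemma relay_process_measurable:
  assumes "i < 2" "t \<in> {0..horizon}"
  shows "relay_process i t \<in> borel_measurable joint"
proof -
  obtain \<Phi> where \<Phi>: "\<Phi> \<in> borel_measurable (uniform_count_measure (message_tuples 2 horizon R)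
      \<Otimes>\<^sub>M (\<Pi>\<^sub>M j\<in>{..<2}. \<Pi>\<^sub>M r\<in>{0..t}. borel))"
    and eq: "\<And>w b. relay_output w b i t = \<Phi> (w, \<lambda>j\<in>{..<2}. \<lambda>r\<in>{0..t}. b j r)"
    using relay_output_adapted[OF assms] by blast
  have "(\<lambda>p. (fst p, \<lambda>j\<in>{..<2}. \<lambda>r\<in>{0..t}. B j r (snd p)))
      \<in> joint \<rightarrow>\<^sub>M uniform_count_measure (message_tuples 2 horizon R)
        \<Otimes>\<^sub>M (\<Pi>\<^sub>M j\<in>{..<2}. \<Pi>\<^sub>M r\<in>{0..t}. borel)"
    unfolding joint_space_def
    by (intro measurable_Pair measurable_fst measurable_restrict
        measurable_compose[OF measurable_snd noise_measurable]) auto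
  from measurable_compose[OF this \<Phi>] show ?thesis
    unfolding relay_process_def[abs_def] eq .
qed

text \<open>The inputs integrate to ramps, so the channel equations become the fixed-point identity
  for \<open>relay_output\<close>, which holds at every point of the joint space.\<close>

lemma relay_channel_output:
  "channel_output 2 cross_gains N B horizon R relay_encoder relay_process"
  unfolding channel_output_def
proof (intro conjI allI impI ballI)
  fix i p assume "i < (2::nat)" "p \<in> space joint"
  then have "continuous_on {0..} (\<lambda>t. B i t (snd p))"
    using brownian[of i] by (auto simp: standard_brownian_motion_def space_joint_space)
  then have "continuous_on {0..horizon} (\<lambda>t. B i t (snd p))"
    by (rule continuous_on_subset) auto
  then show "continuous_on {0..horizon} (\<lambda>t. relay_process i t p)"
    unfolding relay_process_def relay_output_def first_phase_def ramp_def
    by (intro continuous_intros)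
next
  fix i t assume it: "i < (2::nat)" "t \<in> {0..horizon}"
  show "relay_process i t \<in> borel_measurable joint"
    by (rule relay_process_measurable[OF it])
  show "\<exists>\<Phi>\<in>borel_measurable (uniform_count_measure (message_tuples 2 horizon R)
      \<Otimes>\<^sub>M (\<Pi>\<^sub>M j\<in>{..<2}. \<Pi>\<^sub>M r\<in>{0..t}. borel)).
    AE p in joint. relay_process i t p = \<Phi> (fst p, \<lambda>j\<in>{..<2}. \<lambda>r\<in>{0..t}. B j r (snd p))"
    using relay_output_adapted[OF it] unfolding relay_process_def by fastforce
next
  show "AE p in joint.
      (\<forall>j<2. set_integrable lborel {0..horizon} (\<lambda>s. channel_input relay_encoder relay_process j s p)) \<and>
      (\<forall>i<2. \<forall>t\<in>{0..horizon}. relay_process i t p =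
        (\<Sum>j<2. cross_gains i j * (LINT s:{0..t}|lborel. channel_input relay_encoder relay_process j s p))
        + B i t (snd p))"
  proof (rule AE_I2, intro conjI allI impI ballI relay_input_integrable)
    fix p i t assume "p \<in> space joint" "i < (2::nat)" "t \<in> {0..horizon}"
    moreover have "relay_process i t p = ramp (fst p (1 - i)) t
        + ramp (M + detect 0 (\<lambda>r. relay_process (1 - i) r p)) t + B i t (snd p)"
      unfolding relay_process_def by (rule relay_output_fixed_point)
    ultimately show "relay_process i t p =
        (\<Sum>j<2. cross_gains i j * (LINT s:{0..t}|lborel. channel_input relay_encoder relay_process j s p))
        + B i t (snd p)"
      using channel_equation[of p i t relay_process] by simp
  qed
qed

text \<open>Any other solution obeys the same ramp equations almost surely, and these determine
  first the estimates and then the paths.\<close>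

lemma relay_unique_channel_output:
  "unique_channel_output 2 cross_gains N B horizon R relay_encoder relay_process"
  unfolding unique_channel_output_def
proof (intro conjI allI impI relay_channel_output)
  fix Y assume "channel_output 2 cross_gains N B horizon R relay_encoder Y"
  then have "AE p in joint. \<forall>i<2. \<forall>t\<in>{0..horizon}. Y i t p =
      (\<Sum>j<2. cross_gains i j * (LINT s:{0..t}|lborel. channel_input relay_encoder Y j s p)) + B i t (snd p)"
    by (auto simp: channel_output_def)
  then show "AE p in joint. \<forall>i<2. \<forall>t\<in>{0..horizon}. Y i t p = relay_process i t p"
    using AE_space
  proof eventually_elim
    case (elim p)
    show ?case
      unfolding relay_process_def
      using elim(1) channel_equation[OF elim(2)]
      by (intro allI impI ballI relay_output_unique[where y = "\<lambda>i t. Y i t p"]) auto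
  qed
qed

lemma measurable_relay_encoder: "measurable_encoder 2 horizon R relay_encoder"
  unfolding measurable_encoder_def
proof (intro allI impI ballI)
  fix i k
  let ?Q = "restrict_space borel {0..horizon} \<Otimes>\<^sub>M path_space horizon"
  have time: "fst \<in> borel_measurable ?Q"
    by (rule measurable_compose[OF measurable_fst]) (simp add: measurable_restrict_space1)
  have pulse: "(\<lambda>z. pulse l (fst z)) \<in> borel_measurable ?Q" for l
    using measurable_compose[OF time, of "pulse l" borel] unfolding pulse_def[abs_def] by simp
  have "(\<lambda>z. detect 0 (snd z)) \<in> ?Q \<rightarrow>\<^sub>M count_space UNIV"
    by (intro measurable_compose[OF measurable_snd] measurable_detect measurable_slot) auto
  \<comment> \<open>The estimate takes countably many values, and for each of them the pulse is
    measurable in time.\<close>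
  from measurable_compose_countable[OF pulse this, of "\<lambda>l. M + l"]
  have "(\<lambda>z. pulse (M + detect 0 (snd z)) (fst z)) \<in> borel_measurable ?Q" .
  with pulse[of k] have "(\<lambda>z. pulse k (fst z) + pulse (M + detect 0 (snd z)) (fst z)) \<in> borel_measurable ?Q"
    by (intro borel_measurable_add)
  \<comment> \<open>Causality removes the restriction to \<open>{0..s}\<close>, whose domain varies
    with \<open>s\<close>.\<close>
  then show "(\<lambda>(s, y). relay_encoder i k s (restrict y {0..s})) \<in> borel_measurable ?Q"
    by (simp add: relay_encoder_def relayed_pulse_causal case_prod_unfold)
qed

lemma measurable_relay_decoder:
  assumes "i < 2"
  shows "relay_decoder i \<in> path_space horizon \<rightarrow>\<^sub>M count_space {1..nat \<lfloor>exp (horizon * R i)\<rfloor>}"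
proof -
  have "(\<lambda>y. detect M y) \<in> path_space horizon \<rightarrow>\<^sub>M count_space UNIV"
    by (intro measurable_detect measurable_slot) auto
  then have "(\<lambda>y. detect M y) \<in> path_space horizon \<rightarrow>\<^sub>M restrict_space (count_space UNIV) {1..M}"
    using detect_bounds by (intro measurable_restrict_space2) auto
  then show ?thesis
    using alphabet[OF assms] by (simp add: relay_decoder_def restrict_count_space)
qed

lemma relay_code:
  "code 2 cross_gains P N B horizon R relay_encoder relay_process relay_decoder"
  unfolding code_def
proof (intro conjI allI impI)
  fix i assume i: "i < (2::nat)"
  show "AE p in joint. ennreal (1 / horizon) *
      (\<integral>\<^sup>+s\<in>{0..horizon}. ennreal ((channel_input relay_encoder relay_process i s p)\<^sup>2) \<partial>lborel) \<le> ennreal (P i)"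
  proof (rule AE_I2)
    fix p assume "p \<in> space joint"
    then have "fst p i \<le> M"
      using i message_bounds[of "fst p" i] by (auto simp: space_joint_space)
    have "(\<integral>\<^sup>+s\<in>{0..horizon}. ennreal ((channel_input relay_encoder relay_process i s p)\<^sup>2) \<partial>lborel)
        = (\<integral>\<^sup>+s\<in>{0..horizon}. ennreal ((pulse (fst p i) s
            + pulse (M + detect 0 (\<lambda>r. relay_process i r p)) s)\<^sup>2) \<partial>lborel)"
      by (intro nn_integral_cong) (auto simp: relay_input indicator_def)
    also have "\<dots> \<le> ennreal (2 * A\<^sup>2 * d)"
      using \<open>fst p i \<le> M\<close> by (intro relay_energy detect_bounds)
    finally have "ennreal (1 / horizon) *
        (\<integral>\<^sup>+s\<in>{0..horizon}. ennreal ((channel_input relay_encoder relay_process i s p)\<^sup>2) \<partial>lborel)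
        \<le> ennreal (1 / horizon) * ennreal (2 * A\<^sup>2 * d)"
      by (rule mult_left_mono) simp
    \<comment> \<open>The energy \<open>2 * A\<^sup>2 * d\<close> spread over the horizon
      \<open>2 * M * d\<close>; this is where the assumption \<open>power\<close> comes
      from.\<close>
    also have "\<dots> = ennreal (A\<^sup>2 / M)"
      using d_pos M_ge_1 horizon_pos by (simp add: ennreal_mult''[symmetric] horizon_def)
    also have "\<dots> \<le> ennreal (P i)"
      using power[OF i] M_ge_1 by (intro ennreal_leI) (simp add: field_simps)
    finally show "ennreal (1 / horizon) *
        (\<integral>\<^sup>+s\<in>{0..horizon}. ennreal ((channel_input relay_encoder relay_process i s p)\<^sup>2) \<partial>lborel)
        \<le> ennreal (P i)" .
  qed
qed (simp_all del: One_nat_def add: horizon_pos rate_pos measurable_relay_encoder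
    relay_unique_channel_output measurable_relay_decoder)

text \<open>A slot increment of the noise has variance \<open>d\<close>, so the tail bound at
  \<open>A * d / 2\<close> has exponent
  \<open>(A * d / 2)\<^sup>2 / (4 * d) = A\<^sup>2 * d / 16\<close>.\<close>

lemma large_noise_slot:
  assumes "j < 2" "1 \<le> k"
  shows "measure N {\<omega> \<in> space N. A * d / 2 \<le> \<bar>slot (\<lambda>t. B j t \<omega>) k\<bar>} \<le> sqrt 2 * exp (- (A\<^sup>2 * d) / 16)"
proof -
  interpret N: prob_space N by (rule prob_space_noise)
  have "(real k - 1) * d < real k * d" "real k * d - (real k - 1) * d = d"
    using d_pos by (simp_all add: algebra_simps)
  then have "distributed N lborel (\<lambda>\<omega>. B j (real k * d) \<omega> - B j ((real k - 1) * d) \<omega>)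
      (normal_density 0 (sqrt d))"
    using brownian[OF assms(1)] slot_times(1)[OF assms(2)]
    unfolding standard_brownian_motion_def by metis
  then have "distributed N lborel (\<lambda>\<omega>. slot (\<lambda>t. B j t \<omega>) k) (normal_density 0 (sqrt d))"
    by (simp add: slot_def)
  from N.normal_tail_bound[OF this, of "A * d / 2"] show ?thesis
    using d_pos A_pos by (simp add: power_mult_distrib power_divide power2_eq_square mult_ac)
qed

text \<open>Outside the event \<open>bad\<close> every tuple is decoded correctly. As
  \<open>bad\<close> does not depend on the messages, one union bound over two receivers and
  \<open>2 * M\<close> slots covers the whole average.\<close>

lemma relay_error_le:
  "average_error_probability 2 N horizon R relay_process relay_decoder
    \<le> 4 * real M * sqrt 2 * exp (- (A\<^sup>2 * d) / 16)"
proof -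
  interpret N: prob_space N by (rule prob_space_noise)
  let ?I = "{..<2::nat} \<times> {1..M + M}"
  let ?W = "message_tuples 2 horizon R"
  define large where "large = (\<lambda>(j, k). {\<omega> \<in> space N. A * d / 2 \<le> \<bar>slot (\<lambda>t. B j t \<omega>) k\<bar>})"
  define bad where "bad = (\<Union>jk\<in>?I. large jk)"
  have large_sets: "large jk \<in> sets N" if "jk \<in> ?I" for jk
  proof -
    obtain j k where jk: "jk = (j, k)" "j < 2" "1 \<le> k" using \<open>jk \<in> ?I\<close> by auto
    have "(\<lambda>\<omega>. slot (\<lambda>t. B j t \<omega>) k) \<in> borel_measurable N"
      unfolding slot_def using jk slot_times[of k]
      by (intro borel_measurable_diff noise_measurable) auto
    then show ?thesis unfolding jk large_def by simp
  qed
  have "measure N bad \<le> (\<Sum>jk\<in>?I. measure N (large jk))"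
    unfolding bad_def using large_sets by (intro N.finite_measure_subadditive_finite) auto
  also have "\<dots> \<le> (\<Sum>jk\<in>?I. sqrt 2 * exp (- (A\<^sup>2 * d) / 16))"
    using large_noise_slot by (intro sum_mono) (auto simp: large_def)
  also have "\<dots> = 4 * real M * sqrt 2 * exp (- (A\<^sup>2 * d) / 16)"
    by (simp add: card_cartesian_product)
  finally have bad: "measure N bad \<le> 4 * real M * sqrt 2 * exp (- (A\<^sup>2 * d) / 16)" .
  have "measure N {\<omega> \<in> space N. \<exists>i<2. relay_decoder i (\<lambda>t\<in>{0..horizon}. relay_process i t (w, \<omega>)) \<noteq> w i}
      \<le> measure N bad" if w: "w \<in> ?W" for w
  proof (rule N.finite_measure_mono)
    show "bad \<in> sets N" unfolding bad_def using large_sets by (intro sets.finite_UN) auto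
    show "{\<omega> \<in> space N. \<exists>i<2. relay_decoder i (\<lambda>t\<in>{0..horizon}. relay_process i t (w, \<omega>)) \<noteq> w i} \<subseteq> bad"
    proof (rule subsetI, rule ccontr)
      fix \<omega> assume err: "\<omega> \<in> {\<omega> \<in> space N. \<exists>i<2. relay_decoder i (\<lambda>t\<in>{0..horizon}. relay_process i t (w, \<omega>)) \<noteq> w i}"
        and "\<omega> \<notin> bad"
      then have "\<bar>slot (\<lambda>t. B j t \<omega>) k\<bar> < A * d / 2" if "j < 2" "1 \<le> k" "k \<le> M + M" for j k
        using that by (force simp: bad_def large_def)
      then have "detect M (restrict (relay_output w (\<lambda>j t. B j t \<omega>) i) {0..horizon}) = w i" if "i < 2" for i
        using that message_bounds[OF w] by (intro relay_decodes) auto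
      then show False
        using err by (auto simp: relay_decoder_def relay_process_def)
    qed
  qed
  then have "(\<Sum>w\<in>?W. measure N {\<omega> \<in> space N.
      \<exists>i<2. relay_decoder i (\<lambda>t\<in>{0..horizon}. relay_process i t (w, \<omega>)) \<noteq> w i}) \<le> card ?W * measure N bad"
    using sum_mono[of ?W _ "\<lambda>_. measure N bad"] by simp
  then have "average_error_probability 2 N horizon R relay_process relay_decoder \<le> measure N bad"
    unfolding average_error_probability_eq[OF prob_space_noise relay_code]
    by (cases "card ?W = 0") (simp_all add: field_simps)
  with bad show ?thesis by linarith
qed

end

section \<open>Unit rates with feedback, and strict inclusion\<close>

lemma average_error_probability_nonneg: "0 \<le> average_error_probability m N T R Y g"
  unfolding average_error_probability_def cond_prob_def
  by (intro divide_nonneg_nonneg sum_nonneg) auto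

text \<open>The slot length \<open>T / (2 * M)\<close> makes the horizon \<open>T\<close>, and the
  height \<open>8 * sqrt M\<close> gives power 64. The exponent \<open>A\<^sup>2 * d / 16\<close> is
  then \<open>2 * T\<close>; the \<open>4 * M\<close> slots with \<open>M \<le> exp T\<close> cost
  one \<open>T\<close> of it and leave \<open>exp (- T)\<close>. This calculation succeeds for any
  power above 32.\<close>

lemma relay_code_exists:
  assumes noise: "white_gaussian_noise 2 N B" and T: "0 < T"
  defines "R \<equiv> \<lambda>i::nat. if i < 2 then 1 else 0 :: real"
  shows "\<exists>f Y g. f \<in> feedback_encoders \<and> code 2 cross_gains (\<lambda>_. 64) N B T R f Y g \<and>
    average_error_probability 2 N T R Y g \<le> 4 * sqrt 2 * exp (- T)"
proof -
  define M where "M = nat \<lfloor>exp T\<rfloor>"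
  have M: "1 \<le> M" using T by (simp add: M_def le_nat_iff)
  interpret relay M "T / (2 * real M)" "8 * sqrt M"
    using M T by unfold_locales auto
  have hor: "horizon = T" using M by (simp add: horizon_def)
  interpret relay_channel M "T / (2 * real M)" "8 * sqrt M" N B R "\<lambda>_. 64"
    using noise M by unfold_locales (auto simp: hor R_def power_mult_distrib simp flip: M_def)
  have "average_error_probability 2 N T R relay_process relay_decoder
      \<le> 4 * real M * sqrt 2 * exp (- ((8 * sqrt M)\<^sup>2 * (T / (2 * real M))) / 16)"
    using relay_error_le by (simp add: hor)
  also have "(8 * sqrt M)\<^sup>2 * (T / (2 * real M)) = 32 * T"
    using M by (simp add: power_mult_distrib)
  also have "4 * real M * sqrt 2 * exp (- (32 * T) / 16) \<le> 4 * exp T * sqrt 2 * exp (- (32 * T) / 16)"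
    by (intro mult_right_mono mult_left_mono) (auto simp: M_def)
  also have "\<dots> = 4 * sqrt 2 * exp (- T)"
    by (simp add: exp_minus field_simps flip: exp_add)
  finally show ?thesis
    using relay_code unfolding hor by (auto simp: feedback_encoders_def)
qed

lemma feedback_achieves_unit_rates:
  assumes "white_gaussian_noise 2 N B"
  shows "achievable feedback_encoders 2 cross_gains (\<lambda>_. 64) N B (\<lambda>i. if i < 2 then 1 else 0)"
proof -
  let ?R = "\<lambda>i::nat. if i < 2 then 1 else 0 :: real"
  \<comment> \<open>The successor keeps the horizon positive at \<open>n = 0\<close>, as a code
    requires.\<close>
  let ?T = "\<lambda>n. real (Suc n)"
  have "\<forall>n. \<exists>f Y g. f \<in> feedback_encoders \<and> code 2 cross_gains (\<lambda>_. 64) N B (?T n) ?R f Y g \<and>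
      average_error_probability 2 N (?T n) ?R Y g \<le> 4 * sqrt 2 * exp (- ?T n)"
    by (intro allI relay_code_exists[OF assms]) simp
  then obtain f Y g where codes: "\<And>n. f n \<in> feedback_encoders"
      "\<And>n. code 2 cross_gains (\<lambda>_. 64) N B (?T n) ?R (f n) (Y n) (g n)"
    and error: "\<And>n. average_error_probability 2 N (?T n) ?R (Y n) (g n) \<le> 4 * sqrt 2 * exp (- ?T n)"
    by metis
  have T: "filterlim ?T at_top sequentially"
    using filterlim_real_sequentially by (simp only: filterlim_sequentially_Suc)
  then have "(\<lambda>n. exp (- ?T n)) \<longlonglongrightarrow> 0"
    by (intro filterlim_compose[OF exp_at_bot] filterlim_compose[OF filterlim_uminus_at_bot_at_top])
  from tendsto_mult_left[OF this, of "4 * sqrt 2"]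
  have "(\<lambda>n. 4 * sqrt 2 * exp (- ?T n)) \<longlonglongrightarrow> 0" by simp
  then have "(\<lambda>n. average_error_probability 2 N (?T n) ?R (Y n) (g n)) \<longlonglongrightarrow> 0"
    by (rule tendsto_sandwich[rotated 3, OF _ _ _ tendsto_const])
      (use error average_error_probability_nonneg in \<open>auto intro!: always_eventually\<close>)
  with T codes show ?thesis
    unfolding achievable_def by (intro conjI exI[of _ ?T] exI[of _ f] exI[of _ Y] exI[of _ g]) auto
qed

theorem theorem5p6:
  shows "\<exists>(m::nat) (a :: nat \<Rightarrow> nat \<Rightarrow> real) (P :: nat \<Rightarrow> real).
    1 \<le> m \<and> (\<forall>i<m. 0 < P i) \<and>
    (\<forall>(N :: 'w measure) (B :: nat \<Rightarrow> real \<Rightarrow> 'w \<Rightarrow> real).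
       white_gaussian_noise m N B \<longrightarrow>
       capacity_region nonfeedback_encoders m a P N B \<subset> capacity_region feedback_encoders m a P N B)"
proof (intro exI conjI allI impI)
  \<comment> \<open>The witnesses \<open>2\<close>, \<open>cross_gains\<close> and constant power 64
    are still schematic and get fixed by the inclusion shown below.\<close>
  fix N :: "'w measure" and B :: "nat \<Rightarrow> real \<Rightarrow> 'w \<Rightarrow> real"
  assume noise: "white_gaussian_noise 2 N B"
  then have "capacity_region nonfeedback_encoders 2 cross_gains (\<lambda>_. 64) N B = {}"
    by (intro nonfeedback_capacity_region_empty) (simp add: white_gaussian_noise_def)
  \<comment> \<open>The unit rate pair vanishes from index 2 on and so is a point of
    \<open>Euclidean_space 2\<close>; one such point makes the inclusion of the empty region
    strict.\<close>
  moreover have "(\<lambda>i. if i < 2 then 1 else 0) \<in> capacity_region feedback_encoders 2 cross_gains (\<lambda>_. 64) N B"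
    unfolding capacity_region_def
    by (intro subsetD[OF closure_of_subset]) (auto simp: topspace_Euclidean_space feedback_achieves_unit_rates[OF noise])
  ultimately show "capacity_region nonfeedback_encoders 2 cross_gains (\<lambda>_. 64) N B
      \<subset> capacity_region feedback_encoders 2 cross_gains (\<lambda>_. 64) N B"
    by blast
qed auto

end
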